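(* Let $M$ be a $0/\pm 1$ matrix, let $X=\mathrm{Geom}(M)$ be its geometric grid class, and let $\mathcal{G}_X=\{G_\pi : \pi\in X\}$ be the corresponding class of permutation graphs. Then there is a finite integer $k$ such that every graph in $\mathcal{G}_X$ is a $k$-letter graph.
   Context: Permutation graph: for a permutation $\pi$ of $\{1,\dots,n\}$, $G_\pi$ has vertex set $\{1,\dots,n\}$, with $i$ and $j$ adjacent iff $(i-j)(\pi(i)-\pi(j))<0$. Geometric grid class: matrices are indexed first by column (left to right) and then by row (bottom to top). For a $t\times u$ matrix $M$ with entries in $\{0,1,-1\}$, its standard figure is the subset of $\mathbb{R}^2$ consisting, for each $(k,\ell)$, of the open line segment from $(k-1,\ell-1)$ to $(k,\ell)$ if $M_{k,\ell}=1$, or the open segment from $(k-1,\ell)$ to $(k,\ell-1)$ if $M_{k,\ell}=-1$ (nothing if $M_{k,\ell}=0$). $\mathrm{Geom}(M)$ is the set of all permutations obtained as follows: choose $n$ points on the standard figure, no two on a common horizontal or vertical line, label them $1,\dots,n$ from bottom to top, and read the labels from left to right. Letter graphs: for a finite alphabet $\Sigma$, a decoder $\mathcal{P}\subseteq\Sigma^2$ (a set of ordered pairs), and a word $w=w_1\cdots w_n$ over $\Sigma$, the letter graph $G(\mathcal{P},w)$ has vertex set $\{1,\dots,n\}$, where $i<j$ are adjacent iff $(w_i,w_j)\in\mathcal{P}$. The lettericity of a graph $G$ is the minimum $\ell$ such that $G$ is isomorphic to $G(\mathcal{P},w)$ for some alphabet $\Sigma$ with $|\Sigma|=\ell$, some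 decoder $\mathcal{P}\subseteq\Sigma^2$ and some word $w$ over $\Sigma$. A graph is a $k$-letter graph if its lettericity is at most $k$. *)

theory Defs
  imports "HOL-Analysis.Analysis" "HOL-Combinatorics.Permutations"
begin

text \<open>A simple graph is a pair of a vertex set and a set of two-element edges.\<close>

type_synonym 'a graph = "'a set \<times> 'a set set"

definition graph_iso :: "'a graph \<Rightarrow> 'b graph \<Rightarrow> bool" where
  "graph_iso G H \<longleftrightarrow>
     (\<exists>f. bij_betw f (fst G) (fst H) \<and>
          (\<forall>x\<in>fst G. \<forall>y\<in>fst G. {x, y} \<in> snd G \<longleftrightarrow> {f x, f y} \<in> snd H))"

definition perm_graph :: "nat \<Rightarrow> (nat \<Rightarrow> nat) \<Rightarrow> nat graph" where
  "perm_graph n \<pi> =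
     ({1..n},
      {{i, j} | i j. i \<in> {1..n} \<and> j \<in> {1..n} \<and>
                     (int i - int j) * (int (\<pi> i) - int (\<pi> j)) < 0})"

text \<open>
  A matrix with \<open>t\<close> columns and \<open>u\<close> rows is a function \<open>M\<close> whose entry \<open>M k l\<close>, for
  \<open>1 \<le> k \<le> t\<close> and \<open>1 \<le> l \<le> u\<close>, lies in column \<open>k\<close> (from the left) and row \<open>l\<close>
  (from the bottom). Values outside this range are ignored.
\<close>

definition standard_figure :: "nat \<Rightarrow> nat \<Rightarrow> (nat \<Rightarrow> nat \<Rightarrow> int) \<Rightarrow> (real \<times> real) set" where
  "standard_figure t u M =
     (\<Union>k\<in>{1..t}. \<Union>l\<in>{1..u}.
        if M k l = 1 then open_segment (real k - 1, real l - 1) (real k, real l)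
        else if M k l = -1 then open_segment (real k - 1, real l) (real k, real l - 1)
        else {})"

text \<open>
  A permutation of \<open>{1..n}\<close> is represented by the pair \<open>(n, \<pi>)\<close>. Below, \<open>p i\<close> is the
  \<open>i\<close>-th point of \<open>A\<close> from the left, and the label of a point is its rank in \<open>A\<close>
  from the bottom.
\<close>

definition Geom :: "nat \<Rightarrow> nat \<Rightarrow> (nat \<Rightarrow> nat \<Rightarrow> int) \<Rightarrow> (nat \<times> (nat \<Rightarrow> nat)) set" where
  "Geom t u M =
     {(n, \<pi>) | n \<pi>. \<pi> permutes {1..n} \<and>
        (\<exists>A p. A \<subseteq> standard_figure t u M \<and> finite A \<and> card A = n \<and>
               inj_on fst A \<and> inj_on snd A \<and>
               bij_betw p {1..n} A \<and>
               (\<forall>i\<in>{1..n}. \<forall>j\<in>{1..n}. i < j \<longrightarrow> fst (p i) < fst (p j)) \<and>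
               (\<forall>i\<in>{1..n}. \<pi> i = card {q \<in> A. snd q \<le> snd (p i)}))}"

definition perm_graph_class :: "(nat \<times> (nat \<Rightarrow> nat)) set \<Rightarrow> nat graph set" where
  "perm_graph_class X = {perm_graph n \<pi> | n \<pi>. (n, \<pi>) \<in> X}"

text \<open>The list \<open>w\<close> is indexed from \<open>0\<close>, the vertices from \<open>1\<close>.\<close>

definition letter_graph :: "('s \<times> 's) set \<Rightarrow> 's list \<Rightarrow> nat graph" where
  "letter_graph P w =
     ({1..length w},
      {{i, j} | i j. i \<in> {1..length w} \<and> j \<in> {1..length w} \<and> i < j \<and>
                     (w ! (i - 1), w ! (j - 1)) \<in> P})"

text \<open>
  Only the cardinality of the alphabet matters, so alphabets are taken to be finite sets
  of natural numbers.
\<close>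

definition lettericity :: "'a graph \<Rightarrow> nat" where
  "lettericity G =
     (LEAST l. \<exists>(\<Sigma> :: nat set) P w. finite \<Sigma> \<and> card \<Sigma> = l \<and> P \<subseteq> \<Sigma> \<times> \<Sigma> \<and> set w \<subseteq> \<Sigma> \<and>
                 graph_iso G (letter_graph P w))"

definition k_letter_graph :: "nat \<Rightarrow> 'a graph \<Rightarrow> bool" where
  "k_letter_graph k G \<longleftrightarrow> lettericity G \<le> k"

text \<open>The minimum in \<open>lettericity\<close> is over a nonempty set for every finite simple graph.\<close>

lemma ex_letter_graph:
  fixes G :: "'a graph"
  assumes fin: "finite (fst G)" and simple: "\<forall>e\<in>snd G. e \<subseteq> fst G \<and> card e = 2"
  shows "\<exists>l (\<Sigma> :: nat set) P w. finite \<Sigma> \<and> card \<Sigma> = l \<and> P \<subseteq> \<Sigma> \<times> \<Sigma> \<and> set w \<subseteq> \<Sigma> \<and>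
           graph_iso G (letter_graph P w)"
proof -
  define n where "n = card (fst G)"
  obtain f where f: "bij_betw f (fst G) {1..n}"
    using fin unfolding n_def by (metis bij_betw_iff_card card_atLeastAtMost diff_Suc_1 finite_atLeastAtMost)
  define P where "P = {(f x, f y) | x y. x \<in> fst G \<and> y \<in> fst G \<and> {x, y} \<in> snd G}"
  define w where "w = [1..<Suc n]"
  have len: "length w = n" and nth: "\<And>i. i \<in> {1..n} \<Longrightarrow> w ! (i - 1) = i"
    by (auto simp: w_def simp del: upt_Suc)
  have fin_n: "f x \<in> {1..n}" if "x \<in> fst G" for x
    using f that by (auto simp: bij_betw_def)
  have inj: "f x = f y \<Longrightarrow> x = y" if "x \<in> fst G" "y \<in> fst G" for x y
    using f that by (auto simp: bij_betw_def inj_on_def)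
  have P: "(f x, f y) \<in> P \<longleftrightarrow> {x, y} \<in> snd G" if "x \<in> fst G" "y \<in> fst G" for x y
    using that inj unfolding P_def by blast
  have E: "{a, b} \<in> snd (letter_graph P w) \<longleftrightarrow> (a < b \<and> (a, b) \<in> P) \<or> (b < a \<and> (b, a) \<in> P)"
    if "a \<in> {1..n}" "b \<in> {1..n}" for a b
  proof -
    have "{a, b} \<in> snd (letter_graph P w) \<longleftrightarrow>
        (\<exists>i j. {a, b} = {i, j} \<and> i \<in> {1..n} \<and> j \<in> {1..n} \<and> i < j \<and> (w ! (i - 1), w ! (j - 1)) \<in> P)"
      by (simp add: letter_graph_def len)
    also have "\<dots> \<longleftrightarrow> (\<exists>i j. {a, b} = {i, j} \<and> i \<in> {1..n} \<and> j \<in> {1..n} \<and> i < j \<and> (i, j) \<in> P)"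
      using nth by metis
    also have "\<dots> \<longleftrightarrow> (a < b \<and> (a, b) \<in> P) \<or> (b < a \<and> (b, a) \<in> P)"
      using that by (auto simp: doubleton_eq_iff)
    finally show ?thesis .
  qed
  have "{x, y} \<in> snd G \<longleftrightarrow> {f x, f y} \<in> snd (letter_graph P w)"
    if xy: "x \<in> fst G" "y \<in> fst G" for x y
  proof -
    have "x \<noteq> y" if "{x, y} \<in> snd G" using simple that by fastforce
    then have "f x < f y \<or> f y < f x" if "{x, y} \<in> snd G"
      using inj[OF xy] that by (meson linorder_neqE_nat)
    then show ?thesis
      using E[OF fin_n[OF xy(1)] fin_n[OF xy(2)]] P xy by (auto simp: insert_commute)
  qed
  then have "graph_iso G (letter_graph P w)"
    unfolding graph_iso_def using f len by (auto simp: letter_graph_def)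
  moreover have "P \<subseteq> {1..n} \<times> {1..n}" using fin_n unfolding P_def by blast
  moreover have "set w \<subseteq> {1..n}" by (auto simp: w_def)
  ultimately show ?thesis by (metis finite_atLeastAtMost)
qed

end

theory Submission imports Defs
begin

text \<open>
  A point of the standard figure lies on a diagonal of a unit cell, so if \<open>d\<close> is its horizontal
  distance from the centre \<open>(k - 1/2, l - 1/2)\<close> of that cell, then \<open>d\<close> is also its vertical
  distance, and the point is \<open>(k - 1/2 + \<sigma> d, l - 1/2 + \<tau> d)\<close> with signs \<open>\<sigma>\<close> and \<open>\<tau>\<close>. Write the
  points in order of increasing \<open>d\<close> and use \<open>(k, \<sigma>, l, \<tau>)\<close> as the letter of a point. Of two points
  in the same column, the one with the larger \<open>d\<close> is on the right of the other iff its own sign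
  \<open>\<sigma>\<close> is positive, and likewise for rows; hence two letters and their order in the word determine
  whether the points form an inversion. This uses at most \<open>4 t u\<close> letters.
\<close>

lemma doubleton_in_letter_graph:
  assumes "i < j" "1 \<le> i" "j \<le> length w"
  shows "{i, j} \<in> snd (letter_graph P w) \<longleftrightarrow> (w ! (i - 1), w ! (j - 1)) \<in> P"
proof
  show "(w ! (i - 1), w ! (j - 1)) \<in> P" if "{i, j} \<in> snd (letter_graph P w)"
    using that assms(1) by (auto simp: letter_graph_def doubleton_eq_iff)
  have "i \<in> {1..length w}" "j \<in> {1..length w}"
    using assms by auto
  then show "{i, j} \<in> snd (letter_graph P w)" if "(w ! (i - 1), w ! (j - 1)) \<in> P"
    using that assms(1) unfolding letter_graph_def snd_conv by blast
qed

lemma singleton_notin_letter_graph: "{i} \<notin> snd (letter_graph P w)"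
  by (auto simp: letter_graph_def)

lemma doubleton_in_perm_graph:
  assumes "i \<in> {1..n}" "j \<in> {1..n}"
  shows "{i, j} \<in> snd (perm_graph n \<pi>) \<longleftrightarrow> (int i - int j) * (int (\<pi> i) - int (\<pi> j)) < 0"
proof -
  \<comment> \<open>An edge can be read as \<open>(i, j)\<close> or as \<open>(j, i)\<close>; the
    product is symmetric, so both readings agree.\<close>
  have "(int j - int i) * (int (\<pi> j) - int (\<pi> i)) = (int i - int j) * (int (\<pi> i) - int (\<pi> j))"
    by (simp add: algebra_simps)
  then show ?thesis
    using assms by (auto simp: perm_graph_def doubleton_eq_iff)
qed

lemma singleton_notin_perm_graph: "{i} \<notin> snd (perm_graph n \<pi>)"
  by (auto simp: perm_graph_def)

text \<open>The isomorphism sends a vertex to its position in \<open>xs\<close>. As edges are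
  unordered, positions \<open>i < j\<close> suffice; \<open>loop\<close> handles
  \<open>x = y\<close>, which \<open>graph_iso\<close> also compares.\<close>

lemma graph_iso_letter_graphI:
  assumes dist: "distinct xs" and V: "set xs = fst G"
    and loop: "\<And>x. {x} \<notin> snd G"
    and edge: "\<And>i j. \<lbrakk>i < j; j < length xs\<rbrakk> \<Longrightarrow>
                 {xs ! i, xs ! j} \<in> snd G \<longleftrightarrow> (letter (xs ! i), letter (xs ! j)) \<in> P"
  shows "graph_iso G (letter_graph P (map letter xs))"
  unfolding graph_iso_def
proof (intro exI conjI ballI)
  let ?H = "letter_graph P (map letter xs)"
  define g where "g i = xs ! (i - 1)" for i
  define f where "f = the_inv_into {1..length xs} g"
  \<comment> \<open>Vertices of a letter graph start at 1, list positions at 0.\<close>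
  have "bij_betw (\<lambda>i. i - 1) {1..length xs} {..<length xs}"
    by (rule bij_betw_byWitness[where f' = Suc]) auto
  from bij_betw_trans[OF this bij_betw_nth[OF dist refl V[symmetric]]]
  have g: "bij_betw g {1..length xs} (fst G)"
    by (simp add: g_def[abs_def] comp_def)
  have verts: "fst ?H = {1..length xs}"
    by (simp add: letter_graph_def)
  show bij: "bij_betw f (fst G) (fst ?H)"
    unfolding f_def verts by (rule bij_betw_the_inv_into[OF g])
  have gf: "xs ! (f x - 1) = x" if "x \<in> fst G" for x
    using f_the_inv_into_f_bij_betw[OF g] that by (auto simp: f_def g_def)
  have less: "{x, y} \<in> snd G \<longleftrightarrow> {f x, f y} \<in> snd ?H"
    if xy: "x \<in> fst G" "y \<in> fst G" and lt: "f x < f y" for x y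
  proof -
    have "f x \<in> {1..length xs}" "f y \<in> {1..length xs}"
      using bij xy verts by (auto simp: bij_betw_def)
    then show ?thesis
      using edge[of "f x - 1" "f y - 1"] lt gf[OF xy(1)] gf[OF xy(2)]
      by (subst doubleton_in_letter_graph) auto
  qed
  fix x y assume xy: "x \<in> fst G" "y \<in> fst G"
  consider "f x < f y" | "f y < f x" | "f x = f y"
    by linarith
  then show "{x, y} \<in> snd G \<longleftrightarrow> {f x, f y} \<in> snd ?H"
  proof cases
    case 1
    then show ?thesis using less xy by blast
  next
    case 2
    then show ?thesis using less[of y x] xy by (simp add: insert_commute)
  next
    case 3
    then have "x = y"
      using bij xy by (auto simp: bij_betw_def inj_on_def)
    then show ?thesis
      using loop singleton_notin_letter_graph by simp
  qed
qed

text \<open>Injectivity of \<open>g\<close> is known only on \<open>C\<close>, so the decoder is cut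
  down to \<open>C \<times> C\<close> first: the image of an outside pair could otherwise coincide
  with that of a pair in \<open>C \<times> C\<close>.\<close>

lemma letter_graph_map:
  assumes "inj_on g C" "set w \<subseteq> C"
  shows "letter_graph (map_prod g g ` (P \<inter> C \<times> C)) (map g w) = letter_graph P w"
proof -
  have "(g a, g b) \<in> map_prod g g ` (P \<inter> C \<times> C) \<longleftrightarrow> (a, b) \<in> P" if "a \<in> C" "b \<in> C" for a b
  proof
    show "(a, b) \<in> P" if "(g a, g b) \<in> map_prod g g ` (P \<inter> C \<times> C)"
      using that assms(1) \<open>a \<in> C\<close> \<open>b \<in> C\<close> by (auto simp: inj_on_eq_iff)
    show "(g a, g b) \<in> map_prod g g ` (P \<inter> C \<times> C)" if "(a, b) \<in> P"
      using that \<open>a \<in> C\<close> \<open>b \<in> C\<close> by (auto intro!: rev_image_eqI)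
  qed
  moreover have "w ! (i - 1) \<in> C" "map g w ! (i - 1) = g (w ! (i - 1))"
    if "i \<in> {1..length w}" for i
    using that by (auto intro!: subsetD[OF assms(2)])
  ultimately have "(map g w ! (i - 1), map g w ! (j - 1)) \<in> map_prod g g ` (P \<inter> C \<times> C) \<longleftrightarrow>
      (w ! (i - 1), w ! (j - 1)) \<in> P"
    if "i \<in> {1..length w}" "j \<in> {1..length w}" for i j
    using that by metis
  then have "{{i, j} |i j. i \<in> {1..length w} \<and> j \<in> {1..length w} \<and> i < j \<and>
        (map g w ! (i - 1), map g w ! (j - 1)) \<in> map_prod g g ` (P \<inter> C \<times> C)} =
      {{i, j} |i j. i \<in> {1..length w} \<and> j \<in> {1..length w} \<and> i < j \<and>
        (w ! (i - 1), w ! (j - 1)) \<in> P}"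
    by (intro Collect_cong ex_cong1 conj_cong refl) assumption
  then show ?thesis
    by (simp only: letter_graph_def length_map)
qed

text \<open>Renaming letters to numbers below \<open>card C\<close> lets words over tuples bound
  \<open>lettericity\<close>, whose alphabets consist of naturals.\<close>

lemma lettericity_le_card:
  assumes fin: "finite C" and w: "set w \<subseteq> C" and iso: "graph_iso G (letter_graph P w)"
  shows "lettericity G \<le> card C"
proof -
  obtain g where g: "bij_betw g C {0..<card C}"
    using fin ex_bij_betw_finite_nat by blast
  then have inj: "inj_on g C" and img: "g ` C = {0..<card C}"
    by (auto simp: bij_betw_def)
  let ?P = "map_prod g g ` (P \<inter> C \<times> C)"
  have "graph_iso G (letter_graph ?P (map g w))"
    using iso letter_graph_map[OF inj w] by simp
  moreover have "?P \<subseteq> {0..<card C} \<times> {0..<card C}"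
    unfolding img[symmetric] by auto
  moreover have "set (map g w) \<subseteq> {0..<card C}"
    unfolding img[symmetric] using w by auto
  ultimately show ?thesis
    unfolding lettericity_def
    by (intro Least_le exI[of _ "{0..<card C}"] exI[of _ ?P] exI[of _ "map g w"]) simp
qed

definition unit_sign :: "bool \<Rightarrow> real" where
  "unit_sign b = (if b then 1 else -1)"

lemma standard_figure_coords:
  assumes "q \<in> standard_figure t u M"
  obtains k \<sigma> l \<tau> d where "k \<in> {1..t}" "l \<in> {1..u}" "0 \<le> d" "d < 1/2"
    "fst q = real k - 1/2 + unit_sign \<sigma> * d" "snd q = real l - 1/2 + unit_sign \<tau> * d"
proof -
  obtain k l where kl: "k \<in> {1..t}" "l \<in> {1..u}"
    and seg: "q \<in> open_segment (real k - 1, real l - 1) (real k, real l) \<or>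
              q \<in> open_segment (real k - 1, real l) (real k, real l - 1)"
    using assms unfolding standard_figure_def by (auto split: if_splits)
  obtain s where s: "0 < s" "s < 1" "fst q = real k - 1 + s"
    and y: "snd q = real l - 1 + s \<or> snd q = real l - s"
    using seg unfolding in_segment by (auto simp: algebra_simps)
  \<comment> \<open>At the centre of a cell \<open>d = 0\<close>, so either sign is correct
    there.\<close>
  define \<sigma> where "\<sigma> \<longleftrightarrow> s \<ge> 1/2"
  define d where "d = \<bar>s - 1/2\<bar>"
  have x: "fst q = real k - 1/2 + unit_sign \<sigma> * d"
    using s by (auto simp: unit_sign_def \<sigma>_def d_def)
  have "\<exists>\<tau>. snd q = real l - 1/2 + unit_sign \<tau> * d"
    using y
  proof
    assume "snd q = real l - 1 + s"
    then show ?thesis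
      by (intro exI[of _ \<sigma>]) (auto simp: unit_sign_def \<sigma>_def d_def)
  next
    assume "snd q = real l - s"
    then show ?thesis
      \<comment> \<open>On a falling diagonal the vertical offset \<open>1/2 - s\<close> is the
        negative of the horizontal one.\<close>
      by (intro exI[of _ "\<not> \<sigma>"]) (auto simp: unit_sign_def \<sigma>_def d_def)
  qed
  moreover have "0 \<le> d" "d < 1/2"
    using s(1,2) unfolding d_def by linarith+
  ultimately show ?thesis
    using that kl x by blast
qed

text \<open>Values with \<open>k \<noteq> k'\<close> lie in disjoint open unit intervals. For
  \<open>k = k'\<close> the offset \<open>d'\<close> is at least as large as \<open>d\<close>, so
  its sign decides; ties \<open>d = d'\<close> do no harm because the two values differ.\<close>

lemma coord_less_iff:
  fixes k k' :: nat
  assumes "0 \<le> d" "d \<le> d'" "d' < 1/2"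
    and "real k - 1/2 + unit_sign \<sigma> * d \<noteq> real k' - 1/2 + unit_sign \<sigma>' * d'"
  shows "real k - 1/2 + unit_sign \<sigma> * d < real k' - 1/2 + unit_sign \<sigma>' * d' \<longleftrightarrow> k < k' \<or> k = k' \<and> \<sigma>'"
proof -
  have "real k + 1 \<le> real k'" if "k < k'"
    using that by linarith
  moreover have "real k' + 1 \<le> real k" if "k' < k"
    using that by linarith
  ultimately show ?thesis
    using assms by (cases k k' rule: linorder_cases) (auto simp: unit_sign_def split: if_splits)
qed

text \<open>The first letter belongs to the point with the smaller \<open>d\<close>. The two sides
  then say that the second point is to the right of the first and above it; they disagree exactly at
  inversions.\<close>

definition inversion_decoder :: "((nat \<times> bool \<times> nat \<times> bool) \<times> (nat \<times> bool \<times> nat \<times> bool)) set" where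
  "inversion_decoder = {((k, \<sigma>, l, \<tau>), (k', \<sigma>', l', \<tau>')).
     (k < k' \<or> k = k' \<and> \<sigma>') \<noteq> (l < l' \<or> l = l' \<and> \<tau>')}"

text \<open>The bound involves only \<open>t\<close> and \<open>u\<close>, hence is uniform over the
  whole class.\<close>

lemma lettericity_perm_graph_Geom:
  assumes "(n, \<pi>) \<in> Geom t u M"
  shows "lettericity (perm_graph n \<pi>) \<le> card ({1..t} \<times> (UNIV :: bool set) \<times> {1..u} \<times> (UNIV :: bool set))"
proof -
  obtain A p where A: "A \<subseteq> standard_figure t u M" "finite A" "inj_on snd A"
    and p: "bij_betw p {1..n} A"
    and x_mono: "\<And>i j. \<lbrakk>i \<in> {1..n}; j \<in> {1..n}; i < j\<rbrakk> \<Longrightarrow> fst (p i) < fst (p j)"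
    and \<pi>: "\<And>i. i \<in> {1..n} \<Longrightarrow> \<pi> i = card {q \<in> A. snd q \<le> snd (p i)}"
    using assms unfolding Geom_def by auto
  have pA: "p i \<in> A" if "i \<in> {1..n}" for i
    using p that by (auto simp: bij_betw_def)
  have "\<exists>k \<sigma> l \<tau> d. k \<in> {1..t} \<and> l \<in> {1..u} \<and> 0 \<le> d \<and> d < 1/2 \<and>
      fst (p i) = real k - 1/2 + unit_sign \<sigma> * d \<and> snd (p i) = real l - 1/2 + unit_sign \<tau> * d"
    if "i \<in> {1..n}" for i
    using standard_figure_coords[of "p i" t u M] A(1) pA[OF that] by (metis subsetD)
  then obtain k \<sigma> l \<tau> d where coords: "\<And>i. i \<in> {1..n} \<Longrightarrow>
      k i \<in> {1..t} \<and> l i \<in> {1..u} \<and> 0 \<le> d i \<and> d i < 1/2 \<and>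
      fst (p i) = real (k i) - 1/2 + unit_sign (\<sigma> i) * d i \<and>
      snd (p i) = real (l i) - 1/2 + unit_sign (\<tau> i) * d i"
    by metis
  \<comment> \<open>Ranks follow heights: raising the threshold from \<open>p i\<close> to
    \<open>p j\<close> adds at least \<open>p j\<close> to the counted set.\<close>
  have \<pi>_mono: "\<pi> i < \<pi> j" if "i \<in> {1..n}" "j \<in> {1..n}" "snd (p i) < snd (p j)" for i j
  proof -
    have "p j \<in> {q \<in> A. snd q \<le> snd (p j)} - {q \<in> A. snd q \<le> snd (p i)}"
      using that pA by auto
    then have "{q \<in> A. snd q \<le> snd (p i)} \<subset> {q \<in> A. snd q \<le> snd (p j)}"
      using that(3) by fastforce
    then show ?thesis
      using A(2) \<pi> that(1,2) by (simp add: psubset_card_mono)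
  qed
  define letter where "letter i = (k i, \<sigma> i, l i, \<tau> i)" for i
  \<comment> \<open>The word lists the points outwards from the centres of their cells. Equal values
    of \<open>d\<close> may come in any order, since \<open>edge\<close> asks only for
    \<open>d i \<le> d j\<close>.\<close>
  define xs where "xs = sort_key d [1..<Suc n]"
  have xs: "set xs = {1..n}" "distinct xs" "sorted (map d xs)"
    by (auto simp: xs_def simp del: upt_Suc)
  have edge: "{i, j} \<in> snd (perm_graph n \<pi>) \<longleftrightarrow> (letter i, letter j) \<in> inversion_decoder"
    if i: "i \<in> {1..n}" and j: "j \<in> {1..n}" and "i \<noteq> j" and le: "d i \<le> d j" for i j
  proof -
    have x_neq: "fst (p i) \<noteq> fst (p j)"
      using x_mono[OF i j] x_mono[OF j i] \<open>i \<noteq> j\<close> by (cases i j rule: linorder_cases) auto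
    then have "p i \<noteq> p j"
      by auto
    then have y_neq: "snd (p i) \<noteq> snd (p j)"
      using A(3) pA[OF i] pA[OF j] by (auto simp: inj_on_def)
    have "fst (p i) < fst (p j) \<longleftrightarrow> k i < k j \<or> k i = k j \<and> \<sigma> j"
      using coord_less_iff[of "d i" "d j" "k i" "\<sigma> i" "k j" "\<sigma> j"] le x_neq coords[OF i] coords[OF j]
      by metis
    moreover have "i < j \<longleftrightarrow> fst (p i) < fst (p j)"
      using x_mono[OF i j] x_mono[OF j i] \<open>i \<noteq> j\<close> by fastforce
    ultimately have x: "i < j \<longleftrightarrow> k i < k j \<or> k i = k j \<and> \<sigma> j"
      by simp
    have y: "snd (p i) < snd (p j) \<longleftrightarrow> l i < l j \<or> l i = l j \<and> \<tau> j"
      using coord_less_iff[of "d i" "d j" "l i" "\<tau> i" "l j" "\<tau> j"] le y_neq coords[OF i] coords[OF j]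
      by metis
    \<comment> \<open>An inversion is a disagreement between the horizontal and the vertical order;
      by \<open>\<pi>_mono\<close> the latter is the order of the values of
      \<open>\<pi>\<close>.\<close>
    have "(int i - int j) * (int (\<pi> i) - int (\<pi> j)) < 0 \<longleftrightarrow> (i < j) \<noteq> (snd (p i) < snd (p j))"
      using \<pi>_mono[OF i j] \<pi>_mono[OF j i] y_neq \<open>i \<noteq> j\<close>
      by (cases "snd (p i)" "snd (p j)" rule: linorder_cases) (auto simp: mult_less_0_iff)
    then show ?thesis
      using x y doubleton_in_perm_graph[OF i j] by (simp add: inversion_decoder_def letter_def)
  qed
  have "graph_iso (perm_graph n \<pi>) (letter_graph inversion_decoder (map letter xs))"
  proof (rule graph_iso_letter_graphI[OF xs(2)])
    show "set xs = fst (perm_graph n \<pi>)"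
      by (simp add: xs perm_graph_def)
    show "{x} \<notin> snd (perm_graph n \<pi>)" for x
      by (rule singleton_notin_perm_graph)
    fix a b assume ab: "a < b" "b < length xs"
    then have "xs ! a \<in> {1..n}" "xs ! b \<in> {1..n}"
      using xs(1) by (metis nth_mem order.strict_trans)+
    moreover have "xs ! a \<noteq> xs ! b"
      using ab xs(2) by (simp add: nth_eq_iff_index_eq)
    moreover have "d (xs ! a) \<le> d (xs ! b)"
      using ab sorted_nth_mono[OF xs(3), of a b] by simp
    ultimately show "{xs ! a, xs ! b} \<in> snd (perm_graph n \<pi>) \<longleftrightarrow>
        (letter (xs ! a), letter (xs ! b)) \<in> inversion_decoder"
      by (rule edge)
  qed
  moreover have "set (map letter xs) \<subseteq> {1..t} \<times> UNIV \<times> {1..u} \<times> UNIV"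
    using coords xs(1) by (auto simp: letter_def)
  ultimately show ?thesis
    by (intro lettericity_le_card) auto
qed

theorem theorem3:
  fixes t u :: nat and M :: "nat \<Rightarrow> nat \<Rightarrow> int"
  assumes "\<forall>k\<in>{1..t}. \<forall>l\<in>{1..u}. M k l \<in> {0, 1, -1}"
  shows "\<exists>k. \<forall>G\<in>perm_graph_class (Geom t u M). k_letter_graph k G"
  unfolding k_letter_graph_def perm_graph_class_def
  using lettericity_perm_graph_Geom by blast

end
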